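(* Let $d$ be a positive integer. There exists a group $\mathcal{G}$ with a nonabelian, non-normal Sylow $3$-subgroup that contains a difference set $\mathcal{D}$ with parameters $$\left(\frac{3^{3d}(3^{3d}-1)}{2},\ \frac{3^{3d-1}(3^{3d}+1)}{2},\ \frac{3^{3d-1}(3^{3d-1}+1)}{2}\right).$$
   Context: A subset $D$ of a finite group $G$ is a $(v,k,\lambda)$-difference set if $|G|=v$, $|D|=k$, and every $g\in G\setminus\{1\}$ can be expressed in exactly $\lambda$ ways as $d_1d_2^{-1}$ with $d_1,d_2\in D$. The displayed parameters are called Spence parameters. *)

theory Defs
  imports "HOL-Algebra.Sylow"
begin

definition difference_set ::
    "('a, 'b) monoid_scheme \<Rightarrow> nat \<Rightarrow> nat \<Rightarrow> nat \<Rightarrow> 'a set \<Rightarrow> bool" where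
  "difference_set G v k l D \<longleftrightarrow>
     group G \<and> finite (carrier G) \<and> D \<subseteq> carrier G \<and> order G = v \<and> card D = k \<and>
     (\<forall>g \<in> carrier G - {\<one>\<^bsub>G\<^esub>}.
        card {(d1, d2). d1 \<in> D \<and> d2 \<in> D \<and> g = d1 \<otimes>\<^bsub>G\<^esub> inv\<^bsub>G\<^esub> d2} = l)"

(* Sylow p-subgroup of a finite group: a subgroup whose order is the largest
   power of the prime p dividing the order of the group. *)
definition sylow_subgroup :: "nat \<Rightarrow> 'a set \<Rightarrow> ('a, 'b) monoid_scheme \<Rightarrow> bool" where
  "sylow_subgroup p P G \<longleftrightarrow>
     group G \<and> finite (carrier G) \<and> prime p \<and>
     subgroup P G \<and> card P = p ^ multiplicity p (order G)"

(* Spence parameters. In all three, the numerator is even and the natural-number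
   subtractions do not truncate for d \<ge> 1, so div and - are exact. *)
definition spence_v :: "nat \<Rightarrow> nat" where
  "spence_v d = (3 ^ (3 * d) * (3 ^ (3 * d) - 1)) div 2"

definition spence_k :: "nat \<Rightarrow> nat" where
  "spence_k d = (3 ^ (3 * d - 1) * (3 ^ (3 * d) + 1)) div 2"

definition spence_lambda :: "nat \<Rightarrow> nat" where
  "spence_lambda d = (3 ^ (3 * d - 1) * (3 ^ (3 * d - 1) + 1)) div 2"

end

theory Submission
  imports Defs "HOL-Library.Numeral_Type" "HOL-Library.Function_Algebras" "HOL-Library.Product_Plus"
    "HOL-Algebra.Weak_Morphisms" "HOL-Algebra.Elementary_Groups"
begin

text \<open>
  Let \<open>E\<close> be the elementary abelian group of order \<open>3^(3d)\<close> and \<open>K\<close> the cyclic group of order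
  \<open>r = (27^d - 1) / 2\<close>, which is the number of hyperplanes of \<open>E\<close>. Spence's construction labels
  the hyperplanes as \<open>H k\<close> with \<open>k\<close> in \<open>K\<close>, and takes the union of the slices \<open>H k \<times> {k}\<close>,
  except that over the identity of \<open>K\<close> the hyperplane is replaced by its complement. This is a
  difference set of \<open>E \<times> K\<close> because distinct hyperplanes are stochastically independent, while
  every nonzero vector lies in the same number of hyperplanes (\<open>spence_difference_set\<close>).

  The group \<open>E \<times> K\<close> is abelian, so it has to be exchanged for another group that acts regularly
  on the same symmetric design. Suppose that an automorphism \<open>s\<close> of order three preserves the
  difference set, and that \<open>f\<close> is an \<open>s\<close>-invariant homomorphism to the integers modulo 3. Inside
  the semidirect product of the group with \<open>\<langle>s\<rangle>\<close>, the elements \<open>g s^(f g)\<close> form a regular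
  subgroup, and the same set is a difference set for its multiplication
  \<open>x * y = x s^(f x)(y)\<close> (\<open>difference_set_twist\<close>).

  Here \<open>s\<close> acts on \<open>E\<close>, viewed as \<open>d\<close> blocks of three coordinates, by rotating each block, and on
  \<open>K\<close> as multiplication by \<open>3^d\<close>; the homomorphism \<open>f\<close> is the sum of all coordinates. Spence's
  set is invariant if the labelling of hyperplanes is equivariant. An equivariant labelling
  exists since both permutations have order dividing three, act on sets of the same size, and have
  the same number \<open>(3^d - 1) / 2\<close> of fixed points (\<open>order_three_conjugate\<close>,
  \<open>equivariant_half_system\<close>).

  In the twisted group, \<open>E\<close> is still a Sylow 3-subgroup. It is nonabelian because \<open>s\<close> moves some
  vector with coordinate sum 0, and it is not normal because a vector of coordinate sum 1 acts on
  \<open>K\<close> through \<open>s\<close>, which moves the generator 1.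
\<close>

section \<open>Linear algebra over the field with three elements\<close>

lemma F3_cases: "(a::3) = 0 \<or> a = 1 \<or> a = 2"
proof (cases a)
  case (of_int z)
  then have "z = 0 \<or> z = 1 \<or> z = 2" by auto
  then show ?thesis using of_int by auto
qed

lemma F3_induct: "P 0 \<Longrightarrow> P 1 \<Longrightarrow> P 2 \<Longrightarrow> P (a::3)"
  using F3_cases[of a] by metis

lemma F3_square: "(a::3) \<noteq> 0 \<Longrightarrow> a * a = 1"
  using F3_cases[of a] by auto

lemma F3_neg_eq_iff: "- (a::3) = a \<longleftrightarrow> a = 0"
  using F3_cases[of a] by auto

lemma F3_double: "2 * (a::3) = - a"
  using F3_cases[of a] by auto

text \<open>
  Vectors over a finite coordinate set \<open>I\<close> are total functions that vanish outside \<open>I\<close>. In this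
  way the pointwise group operations apply, and the dimension remains an ordinary parameter.
\<close>

definition vecs :: "'i set \<Rightarrow> ('i \<Rightarrow> 3) set" where
  "vecs I = {x. \<forall>i. i \<notin> I \<longrightarrow> x i = 0}"

definition dot :: "'i set \<Rightarrow> ('i \<Rightarrow> 3) \<Rightarrow> ('i \<Rightarrow> 3) \<Rightarrow> 3" where
  "dot I u x = (\<Sum>i\<in>I. u i * x i)"

lemma vecs_closed [simp]:
  "0 \<in> vecs I" "x \<in> vecs I \<Longrightarrow> y \<in> vecs I \<Longrightarrow> x + y \<in> vecs I"
  "x \<in> vecs I \<Longrightarrow> y \<in> vecs I \<Longrightarrow> x - y \<in> vecs I"
  "x \<in> vecs I \<Longrightarrow> - x \<in> vecs I"
  by (auto simp: vecs_def)

lemma dot_simps [simp]: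
  "dot I u (x + y) = dot I u x + dot I u y" "dot I u (x - y) = dot I u x - dot I u y"
  "dot I (- u) x = - dot I u x" "dot I u 0 = 0" "dot I 0 x = 0"
  by (auto simp: dot_def algebra_simps sum.distrib sum_subtractf sum_negf)

lemma dot_commute: "dot I u x = dot I x u"
  by (simp add: dot_def mult.commute)

lemma card_vecs:
  assumes "finite I"
  shows "finite (vecs I)" "card (vecs I) = 3 ^ card I"
proof -
  have b: "bij_betw (\<lambda>x. restrict x I) (vecs I) (I \<rightarrow>\<^sub>E (UNIV :: 3 set))"
    by (rule bij_betw_byWitness[where f' = "\<lambda>x i. if i \<in> I then x i else 0"])
       (auto simp: vecs_def fun_eq_iff PiE_def extensional_def)
  have "finite (I \<rightarrow>\<^sub>E (UNIV :: 3 set))" using assms by (intro finite_PiE) auto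
  then show "finite (vecs I)" using b bij_betw_finite by blast
  show "card (vecs I) = 3 ^ card I"
    using bij_betw_same_card[OF b] assms by (simp add: card_PiE)
qed

lemma vecs_neg_eq_iff: "- (x :: 'i \<Rightarrow> 3) = x \<longleftrightarrow> x = 0"
  using F3_neg_eq_iff by (auto simp: fun_eq_iff)

text \<open>
  All fibres of a homomorphism are translates of each other, so for a surjective one they have
  the same size.
\<close>

lemma card_additive_preimage:
  fixes \<phi> :: "'v::ab_group_add \<Rightarrow> 't::{finite, ab_group_add}"
  assumes fin: "finite V" and diff: "\<And>x y. x \<in> V \<Longrightarrow> y \<in> V \<Longrightarrow> x - y \<in> V"
    and plus: "\<And>x y. x \<in> V \<Longrightarrow> y \<in> V \<Longrightarrow> x + y \<in> V"
    and add: "\<And>x y. x \<in> V \<Longrightarrow> y \<in> V \<Longrightarrow> \<phi> (x + y) = \<phi> x + \<phi> y"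
    and surj: "\<And>t. \<exists>x\<in>V. \<phi> x = t"
  shows "CARD('t) * card {x \<in> V. \<phi> x \<in> S} = card S * card V"
proof -
  define N where "N t = card {x \<in> V. \<phi> x = t}" for t
  have N: "N t = N 0" for t
  proof -
    obtain z where z: "z \<in> V" "\<phi> z = t" using surj by blast
    have sub: "\<phi> (x - z) = \<phi> x - t" if "x \<in> V" for x
      using add[of "x - z" z] diff[OF that z(1)] z by simp
    have "bij_betw (\<lambda>x. x - z) {x \<in> V. \<phi> x = t} {x \<in> V. \<phi> x = 0}"
      by (rule bij_betw_byWitness[where f' = "\<lambda>x. x + z"])
         (use z diff plus add sub in auto)
    then show ?thesis unfolding N_def by (rule bij_betw_same_card)
  qed
  have count: "card {x \<in> V. \<phi> x \<in> T} = card T * N 0" for T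
  proof -
    have "{x \<in> V. \<phi> x \<in> T} = (\<Union>t\<in>T. {x \<in> V. \<phi> x = t})" by auto
    also have "card \<dots> = (\<Sum>t\<in>T. N t)"
      unfolding N_def by (rule card_UN_disjoint) (use fin in auto)
    also have "(\<Sum>t\<in>T. N t) = (\<Sum>t\<in>T. N 0)" by (rule sum.cong) (use N in auto)
    finally show ?thesis by simp
  qed
  have "card V = CARD('t) * N 0" using count[of UNIV] by simp
  then show ?thesis using count[of S] by simp
qed

lemma card_dot_preimage:
  assumes I: "finite I" and u: "u \<in> vecs I" "u \<noteq> 0"
  shows "3 * card {x \<in> vecs I. dot I u x \<in> S} = card S * 3 ^ card I"
proof -
  obtain i where i: "i \<in> I" "u i \<noteq> 0" using u by (auto simp: vecs_def fun_eq_iff)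
  have surj: "\<exists>x\<in>vecs I. dot I u x = t" for t
  proof
    let ?x = "\<lambda>j. if j = i then t * u i else 0"
    show "?x \<in> vecs I" using i by (auto simp: vecs_def)
    show "dot I u ?x = t"
      using i I F3_square[OF i(2)] by (simp add: dot_def if_distrib[of "\<lambda>y. _ * y"] algebra_simps cong: if_cong)
  qed
  have "CARD(3) * card {x \<in> vecs I. dot I u x \<in> S} = card S * card (vecs I)"
    by (rule card_additive_preimage) (use card_vecs[OF I] surj in auto)
  then show ?thesis using card_vecs[OF I] by simp
qed

text \<open>
  Two linear forms that are not proportional take independent values: some \<open>2 \<times> 2\<close> minor of their
  coefficients is nonzero, so already vectors supported on two coordinates realise every pair of
  values.
\<close>

lemma card_dot_preimage2:
  assumes I: "finite I" and u: "u \<in> vecs I" "u \<noteq> 0" and v: "v \<in> vecs I" "v \<noteq> 0"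
    and ind: "v \<noteq> u" "v \<noteq> - u"
  shows "9 * card {x \<in> vecs I. dot I u x \<in> S \<and> dot I v x \<in> T} = card S * card T * 3 ^ card I"
proof -
  obtain i where i: "i \<in> I" "u i \<noteq> 0" using u by (auto simp: vecs_def fun_eq_iff)
  define c where "c = v i * u i"
  \<comment> \<open>Since \<open>u i\<close> is its own inverse, \<open>c\<close> is the only possible factor of proportionality.\<close>
  have "\<exists>j\<in>I. v j \<noteq> c * u j"
  proof (rule ccontr)
    assume "\<not> ?thesis"
    then have "v j = c * u j" for j using u v by (cases "j \<in> I") (auto simp: vecs_def)
    then have "v = 0 \<or> v = u \<or> v = - u"
      using F3_cases[of c] F3_double by (auto simp: fun_eq_iff)
    then show False using v ind by blast
  qed
  then obtain j where j: "j \<in> I" "v j \<noteq> c * u j" by blast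
  define \<delta> where "\<delta> = v j - c * u j"
  have \<delta>: "\<delta> * \<delta> = 1" using j F3_square unfolding \<delta>_def by simp
  have ii: "u i * u i = 1" using F3_square i by simp
  have ij: "i \<noteq> j" using j ii by (auto simp: c_def mult.assoc)
  have surj: "\<exists>x\<in>vecs I. (dot I u x, dot I v x) = st" for st
  proof -
    obtain s t where st: "st = (s, t)" by fastforce
    \<comment> \<open>The solution of the \<open>2 \<times> 2\<close> system by elimination, \<open>\<delta>\<close> being its own inverse.\<close>
    define b where "b = (t - s * c) * \<delta>"
    define x where "x k = (if k = i then s * u i - b * u j * u i else 0) + (if k = j then b else 0)" for k
    have x: "x \<in> vecs I" using i j by (auto simp: vecs_def x_def)
    have dx: "dot I w x = w i * (s * u i - b * u j * u i) + w j * b" for w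
      using i j I by (simp add: dot_def x_def distrib_left sum.distrib if_distrib[of "\<lambda>y. _ * y"] cong: if_cong)
    have "dot I u x = (u i * u i) * (s - b * u j) + u j * b"
      unfolding dx by (simp add: algebra_simps)
    then have 1: "dot I u x = s" using ii by simp
    have "dot I v x = s * c + b * \<delta>"
      unfolding dx c_def \<delta>_def by (simp add: algebra_simps)
    also have "b * \<delta> = (t - s * c) * (\<delta> * \<delta>)" by (simp add: b_def mult.assoc)
    finally have 2: "dot I v x = t" using \<delta> by simp
    show ?thesis using x 1 2 st by auto
  qed
  have "CARD(3 \<times> 3) * card {x \<in> vecs I. (dot I u x, dot I v x) \<in> S \<times> T}
      = card (S \<times> T) * card (vecs I)"
    by (rule card_additive_preimage) (use card_vecs[OF I] surj in auto)
  then show ?thesis using card_vecs[OF I] by (simp add: card_cartesian_product)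
qed

text \<open>
  The nonzero linear forms up to sign are the hyperplanes of the space, equivalently the points of
  the dual projective space. The function \<open>h\<close> selects one form for each of them, labelled by \<open>A\<close>.
\<close>

definition half_system :: "'i set \<Rightarrow> 'k set \<Rightarrow> ('k \<Rightarrow> 'i \<Rightarrow> 3) \<Rightarrow> bool" where
  "half_system I A h \<longleftrightarrow> (\<forall>k\<in>A. h k \<in> vecs I \<and> h k \<noteq> 0) \<and>
     (\<forall>u\<in>vecs I - {0}. \<exists>!k. k \<in> A \<and> (h k = u \<or> h k = - u))"

lemma half_system_unique:
  assumes "half_system I A h" "k \<in> A" "l \<in> A" "h l = h k \<or> h l = - h k"
  shows "l = k"
  using assms unfolding half_system_def by blast

lemma half_system_count:
  assumes h: "half_system I A h" and I: "finite I"
    and U: "U \<subseteq> vecs I - {0}" and neg: "\<And>u. u \<in> U \<Longrightarrow> - u \<in> U"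
  shows "card U = 2 * card {k \<in> A. h k \<in> U}"
proof -
  let ?A = "{k \<in> A. h k \<in> U}"
  have finU: "finite U" using card_vecs(1)[OF I] U by (meson finite_Diff finite_subset)
  have inj: "inj_on h ?A" using half_system_unique[OF h] by (auto intro!: inj_onI)
  then have finA: "finite ?A" using finU inj_on_finite[of h ?A U] by blast
  have "U = (\<Union>k\<in>?A. {h k, - h k})"
  proof
    show "U \<subseteq> (\<Union>k\<in>?A. {h k, - h k})"
    proof
      fix u assume u: "u \<in> U"
      then obtain k where "k \<in> A" "h k = u \<or> h k = - u" using h U unfolding half_system_def by blast
      then show "u \<in> (\<Union>k\<in>?A. {h k, - h k})" using u neg by auto
    qed
  qed (use neg in auto)
  also have "card \<dots> = (\<Sum>k\<in>?A. card {h k, - h k})"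
    using finA by (intro card_UN_disjoint) (auto dest: half_system_unique[OF h])
  also have "\<dots> = (\<Sum>k\<in>?A. 2)"
  proof (rule sum.cong)
    fix k assume "k \<in> ?A"
    then have "h k \<noteq> - h k" using U vecs_neg_eq_iff[of "h k"] by auto
    then show "card {h k, - h k} = 2" by simp
  qed simp
  finally show ?thesis by simp
qed

lemma half_system_card:
  assumes h: "half_system I A h" and I: "finite I"
  shows "2 * card A + 1 = 3 ^ card I"
proof -
  have "card (vecs I - {0}) = 2 * card {k \<in> A. h k \<in> vecs I - {0}}"
    by (rule half_system_count[OF h I]) auto
  also have "{k \<in> A. h k \<in> vecs I - {0}} = A" using h by (auto simp: half_system_def)
  finally have "card (vecs I - {0}) = 2 * card A" .
  moreover have "card (vecs I) = Suc (card (vecs I - {0}))"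
    by (rule card.remove) (use card_vecs[OF I] in auto)
  ultimately show ?thesis using card_vecs[OF I] by linarith
qed

section \<open>Spence difference sets\<close>

definition vec_group :: "'i set \<Rightarrow> ('i \<Rightarrow> 3) monoid" where
  "vec_group I = \<lparr>carrier = vecs I, monoid.mult = (+), one = 0\<rparr>"

lemma vec_group_simps [simp]:
  "carrier (vec_group I) = vecs I" "x \<otimes>\<^bsub>vec_group I\<^esub> y = x + y" "\<one>\<^bsub>vec_group I\<^esub> = 0"
  by (simp_all add: vec_group_def)

lemma vec_group: "group (vec_group I)"
proof (rule groupI)
  fix x assume "x \<in> carrier (vec_group I)"
  then show "\<exists>y\<in>carrier (vec_group I). y \<otimes>\<^bsub>vec_group I\<^esub> x = \<one>\<^bsub>vec_group I\<^esub>"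
    by (intro bexI[of _ "- x"]) auto
qed (auto simp: add.assoc)

text \<open>
  A pair counted for \<open>g\<close> is determined by its second entry, so the count is the size of the
  intersection of \<open>D\<close> with a translate. In this form inversion no longer occurs, which makes it
  easy to change the multiplication.
\<close>

lemma difference_set_iff_translates:
  assumes "group G" "finite (carrier G)" "D \<subseteq> carrier G"
  shows "difference_set G v k l D \<longleftrightarrow> order G = v \<and> card D = k \<and>
     (\<forall>g \<in> carrier G - {\<one>\<^bsub>G\<^esub>}. card {y \<in> D. g \<otimes>\<^bsub>G\<^esub> y \<in> D} = l)"
proof -
  interpret group G by fact
  have "card {(d1, d2). d1 \<in> D \<and> d2 \<in> D \<and> g = d1 \<otimes>\<^bsub>G\<^esub> inv\<^bsub>G\<^esub> d2} = card {y \<in> D. g \<otimes>\<^bsub>G\<^esub> y \<in> D}"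
    if g: "g \<in> carrier G" for g
  proof -
    have eq: "g = d1 \<otimes>\<^bsub>G\<^esub> inv\<^bsub>G\<^esub> d2 \<longleftrightarrow> g \<otimes>\<^bsub>G\<^esub> d2 = d1" if "d1 \<in> D" "d2 \<in> D" for d1 d2
      proof -
      have "d1 \<in> carrier G" "d2 \<in> carrier G" using that assms(3) by auto
      then show ?thesis using g inv_solve_right[of g d1 d2] by metis
    qed
    have "{(d1, d2). d1 \<in> D \<and> d2 \<in> D \<and> g = d1 \<otimes>\<^bsub>G\<^esub> inv\<^bsub>G\<^esub> d2} =
        {(d1, d2). d1 \<in> D \<and> d2 \<in> D \<and> g \<otimes>\<^bsub>G\<^esub> d2 = d1}"
      using eq by blast
    also have "\<dots> = (\<lambda>y. (g \<otimes>\<^bsub>G\<^esub> y, y)) ` {y \<in> D. g \<otimes>\<^bsub>G\<^esub> y \<in> D}"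
      by auto
    finally show ?thesis by (simp add: card_image inj_on_def)
  qed
  then show ?thesis unfolding difference_set_def using assms by simp
qed

definition spence_set :: "'i set \<Rightarrow> ('k, 'b) monoid_scheme \<Rightarrow> ('k \<Rightarrow> 'i \<Rightarrow> 3) \<Rightarrow> (('i \<Rightarrow> 3) \<times> 'k) set" where
  "spence_set I K h =
     {(x, k) \<in> vecs I \<times> carrier K. (dot I (h k) x = 0) = (k \<noteq> \<one>\<^bsub>K\<^esub>)}"

text \<open>
  Let \<open>q = 3^(n + 1)\<close>, so that \<open>K\<close> has \<open>r = (q - 1) / 2\<close> elements. Slices have size \<open>q / 3\<close>,
  but \<open>2 q / 3\<close> over the identity. A translation by \<open>(e, c)\<close> compares the slice over \<open>k\<close> with that
  over \<open>c k\<close>. If \<open>c\<close> is not the identity, independence makes each intersection \<open>q / 9\<close> times a weight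
  1 or 2, the weight 2 occurring for \<open>k = 1\<close> and for \<open>c k = 1\<close>; the total is \<open>(r + 2) q / 9\<close>. If
  \<open>c\<close> is the identity, the slice over \<open>k\<close> contributes \<open>q / 3\<close> when \<open>e\<close> lies in its hyperplane, and
  replacing the hyperplane over the identity by its complement adds \<open>q / 3\<close> in either case. Since
  \<open>e\<close> lies in \<open>(q / 3 - 1) / 2\<close> hyperplanes, both totals agree.
\<close>

theorem spence_difference_set:
  assumes K: "group K" "finite (carrier K)" and h: "half_system I (carrier K) h"
    and I: "finite I" "card I = Suc n"
  shows "difference_set (vec_group I \<times>\<times> K) (3 ^ Suc n * card (carrier K))
           (3 ^ n * (card (carrier K) + 1)) (3 ^ n * (3 ^ n + 1) div 2) (spence_set I K h)"
proof -
  interpret K: group K by fact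
  define V where "V = vecs I"
  let ?C = "carrier K" and ?G = "vec_group I \<times>\<times> K" and ?D = "spence_set I K h"
  \<comment> \<open>\<open>R k\<close> is the set of values that the linear form \<open>h k\<close> takes on the slice over \<open>k\<close>.\<close>
  define R where "R k = (if k = \<one>\<^bsub>K\<^esub> then {1, 2} else {0 :: 3})" for k
  have R: "(t = 0) = (k \<noteq> \<one>\<^bsub>K\<^esub>) \<longleftrightarrow> t \<in> R k" for t k
    using F3_cases[of t] by (auto simp: R_def)
  have D: "?D = {(x, k). x \<in> V \<and> k \<in> ?C \<and> dot I (h k) x \<in> R k}"
    unfolding spence_set_def V_def using R by auto
  have finV: "finite V" using card_vecs I by (simp add: V_def)
  have G: "group ?G" using DirProd_group vec_group K by blast
  have finG: "finite (carrier ?G)" using finV K by (simp add: V_def)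
  have DG: "?D \<subseteq> carrier ?G" by (auto simp: spence_set_def)
  have r: "2 * card ?C + 1 = 3 * 3 ^ n" using half_system_card[OF h I(1)] I by simp
  have hk: "h k \<in> vecs I" "h k \<noteq> 0" if "k \<in> ?C" for k using h that by (auto simp: half_system_def)
  have fibre: "card {x \<in> V. dot I (h k) x \<in> S} = card S * 3 ^ n" if "k \<in> ?C" for k S
    using card_dot_preimage[OF I(1) hk[OF that], of S] I by (simp add: V_def)
  have cR: "card (R k) = 1 + (if k = \<one>\<^bsub>K\<^esub> then 1 else 0)" for k by (auto simp: R_def)
  have slices: "card {(x, k). k \<in> ?C \<and> x \<in> V \<and> P x k} = (\<Sum>k\<in>?C. card {x \<in> V. P x k})" for P
  proof -
    have "{(x, k). k \<in> ?C \<and> x \<in> V \<and> P x k} = prod.swap ` (SIGMA k:?C. {x \<in> V. P x k})" by auto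
    then show ?thesis using K finV by (simp add: card_image)
  qed
  have "card ?D = (\<Sum>k\<in>?C. card {x \<in> V. dot I (h k) x \<in> R k})"
    unfolding D by (subst slices[symmetric]) (auto intro: arg_cong[where f = card])
  also have "\<dots> = (\<Sum>k\<in>?C. card (R k) * 3 ^ n)" by (rule sum.cong) (auto simp: fibre)
  also have "\<dots> = (card ?C + 1) * 3 ^ n"
    unfolding sum_distrib_right[symmetric] cR sum.distrib using K by simp
  finally have cD: "card ?D = 3 ^ n * (card ?C + 1)" by (simp add: mult.commute)
  have "card {y \<in> ?D. g \<otimes>\<^bsub>?G\<^esub> y \<in> ?D} = 3 ^ n * (3 ^ n + 1) div 2" if g: "g \<in> carrier ?G - {\<one>\<^bsub>?G\<^esub>}" for g
  proof -
    obtain e c where ec: "g = (e, c)" "e \<in> V" "c \<in> ?C" "e \<noteq> 0 \<or> c \<noteq> \<one>\<^bsub>K\<^esub>"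
      using g by (cases g) (auto simp: V_def)
    let ?N = "\<lambda>k. card {x \<in> V. dot I (h k) x \<in> R k \<and>
                 dot I (h (c \<otimes>\<^bsub>K\<^esub> k)) e + dot I (h (c \<otimes>\<^bsub>K\<^esub> k)) x \<in> R (c \<otimes>\<^bsub>K\<^esub> k)}"
    have "card {y \<in> ?D. g \<otimes>\<^bsub>?G\<^esub> y \<in> ?D} = (\<Sum>k\<in>?C. ?N k)"
      unfolding D by (subst slices[symmetric]) (use ec in \<open>auto simp: V_def intro!: arg_cong[where f = card]\<close>)
    also have "2 * (\<Sum>k\<in>?C. ?N k) = 3 ^ n * (3 ^ n + 1)"
    proof (cases "c = \<one>\<^bsub>K\<^esub>")
      case True
      then have e: "e \<noteq> 0" using ec by simp
      have N: "?N k = ((if dot I (h k) e = 0 then 1 else 0) + (if k = \<one>\<^bsub>K\<^esub> then 1 else 0)) * 3 ^ n"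
        if k: "k \<in> ?C" for k
      proof -
        let ?a = "dot I (h k) e"
        have "?N k = card {x \<in> V. dot I (h k) x \<in> {t \<in> R k. ?a + t \<in> R k}}"
          using True k by simp
        also have "\<dots> = card {t \<in> R k. ?a + t \<in> R k} * 3 ^ n" by (rule fibre[OF k])
        \<comment> \<open>Over the identity with \<open>?a \<noteq> 0\<close>, only \<open>t = ?a\<close> survives: the other nonzero value is \<open>- ?a\<close>.\<close>
        also have "{t \<in> R k. ?a + t \<in> R k} =
           (if k = \<one>\<^bsub>K\<^esub> then (if ?a = 0 then {1, 2} else {?a}) else (if ?a = 0 then {0} else {}))"
          using F3_cases[of ?a] by (auto simp: R_def)
        finally show ?thesis by auto
      qed
      \<comment> \<open>The hyperplanes through \<open>e\<close> are counted by the forms, up to sign, that are orthogonal to \<open>e\<close>.\<close>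
      let ?Z = "{k \<in> ?C. dot I (h k) e = 0}"
      have "(\<Sum>k\<in>?C. ?N k) = (card ?Z + 1) * 3 ^ n"
        using K by (simp add: N sum_distrib_right[symmetric] sum.distrib sum.If_cases Int_def)
      moreover have "2 * card ?Z + 1 = 3 ^ n"
      proof -
        let ?U = "{u \<in> V. dot I u e = 0}"
        have "card (?U - {0}) = 2 * card {k \<in> ?C. h k \<in> ?U - {0}}"
          by (rule half_system_count[OF h I(1)]) (auto simp: V_def)
        also have "{k \<in> ?C. h k \<in> ?U - {0}} = ?Z" using hk by (auto simp: V_def)
        finally have "card (?U - {0}) = 2 * card ?Z" .
        moreover have "card ?U = Suc (card (?U - {0}))"
          by (rule card.remove) (use finV in \<open>auto simp: V_def\<close>)
        ultimately have "2 * card ?Z + 1 = card ?U" by linarith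
        also have "\<dots> = 3 ^ n"
          using card_dot_preimage[OF I(1), of e "{0}"] e ec I by (simp add: V_def dot_commute)
        finally show ?thesis .
      qed
      ultimately have "3 ^ n + 1 = 2 * (card ?Z + 1)" and "(\<Sum>k\<in>?C. ?N k) = (card ?Z + 1) * 3 ^ n" by auto
      moreover have "2 * S = m * (m + 1)" if "m + 1 = 2 * (z + 1)" "S = (z + 1) * m" for S m z :: nat
        using that by simp
      ultimately show ?thesis by blast
    next
      case False
      have N: "3 * ?N k = 3 ^ n * (card (R k) * card (R (c \<otimes>\<^bsub>K\<^esub> k)))" if k: "k \<in> ?C" for k
      proof -
        let ?l = "c \<otimes>\<^bsub>K\<^esub> k" let ?a = "dot I (h ?l) e"
        have l: "?l \<in> ?C" using k ec by simp
        have "?l \<noteq> k" using False ec k K.r_cancel_one by simp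
        then have ind: "h ?l \<noteq> h k" "h ?l \<noteq> - h k"
          using half_system_unique[OF h k l] by auto
        have "?N k = card {x \<in> vecs I. dot I (h k) x \<in> R k \<and> dot I (h ?l) x \<in> {t. ?a + t \<in> R ?l}}"
          by (simp add: V_def)
        also have "9 * \<dots> = card (R k) * card {t. ?a + t \<in> R ?l} * 3 ^ card I"
          by (rule card_dot_preimage2[OF I(1) hk[OF k] hk[OF l] ind])
        also have "card {t. ?a + t \<in> R ?l} = card (R ?l)"
          by (rule bij_betw_same_card[of "\<lambda>t. ?a + t"], rule bij_betw_byWitness[where f' = "\<lambda>t. t - ?a"]) auto
        finally show ?thesis using I by simp
      qed
      have inv: "c \<otimes>\<^bsub>K\<^esub> k = \<one>\<^bsub>K\<^esub> \<longleftrightarrow> k = inv\<^bsub>K\<^esub> c" if "k \<in> ?C" for k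
        using K.inv_solve_left[of k c "\<one>\<^bsub>K\<^esub>"] ec that
        by (metis K.inv_closed K.one_closed K.r_one)
      have ne: "inv\<^bsub>K\<^esub> c \<noteq> \<one>\<^bsub>K\<^esub>" using False ec by (simp add: K.inv_eq_1_iff)
      have "3 * (\<Sum>k\<in>?C. ?N k) = 3 ^ n * (\<Sum>k\<in>?C. card (R k) * card (R (c \<otimes>\<^bsub>K\<^esub> k)))"
        unfolding sum_distrib_left by (rule sum.cong) (auto simp: N)
      also have "(\<Sum>k\<in>?C. card (R k) * card (R (c \<otimes>\<^bsub>K\<^esub> k))) =
          (\<Sum>k\<in>?C. 1 + (if k = \<one>\<^bsub>K\<^esub> then 1 else 0) + (if k = inv\<^bsub>K\<^esub> c then 1 else 0))"
        by (rule sum.cong) (use ne inv in \<open>auto simp: cR\<close>)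
      also have "\<dots> = card ?C + 2" using K ec unfolding sum.distrib by simp
      finally have "3 * (\<Sum>k\<in>?C. ?N k) = 3 ^ n * (card ?C + 2)" .
      moreover have "2 * S = m * (m + 1)" if "3 * S = m * (c + 2)" "2 * c + 1 = 3 * m" for S m c :: nat
      proof -
        have "3 * (2 * S) = m * (2 * c + 4)" using that(1) by (simp add: algebra_simps)
        also have "2 * c + 4 = 3 * (m + 1)" using that(2) by simp
        also have "m * (3 * (m + 1)) = 3 * (m * (m + 1))" by (rule mult.left_commute)
        finally show ?thesis by linarith
      qed
      ultimately show ?thesis using r by blast
    qed
    finally show ?thesis by linarith
  qed
  moreover have "order ?G = 3 ^ Suc n * card ?C"
    using card_vecs[OF I(1)] I by (simp add: order_def card_cartesian_product)
  ultimately show ?thesis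
    using difference_set_iff_translates[OF G finG DG] cD by blast
qed

section \<open>Twisting a group by an automorphism of order three\<close>

text \<open>
  The exponent is a residue modulo 3, so a representative has to be chosen; for \<open>s\<close> of order
  dividing three this is an action of the additive group of residues.
\<close>

definition twist_power :: "('a \<Rightarrow> 'a) \<Rightarrow> 3 \<Rightarrow> 'a \<Rightarrow> 'a" where
  "twist_power s t = s ^^ (if t = 0 then 0 else if t = 1 then 1 else 2)"

lemma twist_power_simps:
  "twist_power s 0 x = x" "twist_power s 1 x = s x" "twist_power s 2 x = s (s x)"
  by (simp_all add: twist_power_def numeral_2_eq_2)

text \<open>
  The element \<open>x\<close> stands for the product of the translation by \<open>x\<close> with \<open>s^(f x)\<close>, a permutation of
  the original group; multiplication is composition of these permutations.
\<close>

definition twist :: "('a, 'b) monoid_scheme \<Rightarrow> ('a \<Rightarrow> 'a) \<Rightarrow> ('a \<Rightarrow> 3) \<Rightarrow> ('a, 'b) monoid_scheme" where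
  "twist G s f = G\<lparr>monoid.mult := \<lambda>x y. x \<otimes>\<^bsub>G\<^esub> twist_power s (f x) y\<rparr>"

lemma twist_simps [simp]:
  "carrier (twist G s f) = carrier G" "\<one>\<^bsub>twist G s f\<^esub> = \<one>\<^bsub>G\<^esub>" "order (twist G s f) = order G"
  "x \<otimes>\<^bsub>twist G s f\<^esub> y = x \<otimes>\<^bsub>G\<^esub> twist_power s (f x) y"
  by (simp_all add: twist_def order_def)

locale twisting = group G for G (structure) +
  fixes s :: "'a \<Rightarrow> 'a" and f :: "'a \<Rightarrow> 3"
  assumes s_hom: "s \<in> hom G G"
    and s_cube: "x \<in> carrier G \<Longrightarrow> s (s (s x)) = x"
    and f_mult: "x \<in> carrier G \<Longrightarrow> y \<in> carrier G \<Longrightarrow> f (x \<otimes> y) = f x + f y"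
    and f_s: "x \<in> carrier G \<Longrightarrow> f (s x) = f x"
begin

abbreviation "pw \<equiv> twist_power s"

lemma s_closed: "x \<in> carrier G \<Longrightarrow> s x \<in> carrier G"
  using s_hom by (auto simp: hom_def)

lemma s_mult: "x \<in> carrier G \<Longrightarrow> y \<in> carrier G \<Longrightarrow> s (x \<otimes> y) = s x \<otimes> s y"
  using s_hom by (auto simp: hom_def)

lemma pw_closed: "x \<in> carrier G \<Longrightarrow> pw t x \<in> carrier G"
  by (induct t rule: F3_induct) (simp_all add: twist_power_simps s_closed)

lemma pw_mult: "x \<in> carrier G \<Longrightarrow> y \<in> carrier G \<Longrightarrow> pw t (x \<otimes> y) = pw t x \<otimes> pw t y"
  by (induct t rule: F3_induct) (simp_all add: twist_power_simps s_closed s_mult)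

lemma pw_one: "pw t \<one> = \<one>"
  using hom_one[OF s_hom is_group is_group]
  by (induct t rule: F3_induct) (simp_all add: twist_power_simps)

lemma f_pw: "x \<in> carrier G \<Longrightarrow> f (pw t x) = f x"
  by (induct t rule: F3_induct) (simp_all add: twist_power_simps s_closed f_s)

lemma pw_add: "x \<in> carrier G \<Longrightarrow> pw (t + u) x = pw t (pw u x)"
proof -
  assume x: "x \<in> carrier G"
  have "(1::3) + 1 = 2" "(1::3) + 2 = 0" "(2::3) + 1 = 0" "(2::3) + 2 = 1" by simp_all
  then show ?thesis using F3_cases[of t] F3_cases[of u] s_cube s_closed x
    by (elim disjE) (simp_all only: twist_power_simps add_0_left add_0_right)
qed

lemma f_one: "f \<one> = 0"
  using f_mult[of \<one> \<one>] by simp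

lemma f_inv: "x \<in> carrier G \<Longrightarrow> f (inv x) = - f x"
  using f_mult[of "inv x" x] f_one by (simp add: eq_neg_iff_add_eq_0)

lemma group_twist: "group (twist G s f)"
proof (rule groupI)
  fix x y z assume c: "x \<in> carrier (twist G s f)" "y \<in> carrier (twist G s f)" "z \<in> carrier (twist G s f)"
  then show "x \<otimes>\<^bsub>twist G s f\<^esub> y \<in> carrier (twist G s f)" by (simp add: pw_closed)
  show "x \<otimes>\<^bsub>twist G s f\<^esub> y \<otimes>\<^bsub>twist G s f\<^esub> z = x \<otimes>\<^bsub>twist G s f\<^esub> (y \<otimes>\<^bsub>twist G s f\<^esub> z)"
    using c by (simp add: f_mult f_pw pw_closed pw_mult pw_add m_assoc)
next
  fix x assume x: "x \<in> carrier (twist G s f)"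
  then show "\<one>\<^bsub>twist G s f\<^esub> \<otimes>\<^bsub>twist G s f\<^esub> x = x" by (simp add: f_one twist_power_simps)
  have "pw (- f x) (inv x) \<otimes>\<^bsub>twist G s f\<^esub> x = \<one>"
    using x pw_mult[of "inv x" x "- f x"] by (simp add: f_pw pw_one f_inv)
  then show "\<exists>y\<in>carrier (twist G s f). y \<otimes>\<^bsub>twist G s f\<^esub> x = \<one>\<^bsub>twist G s f\<^esub>"
    using x by (intro bexI[of _ "pw (- f x) (inv x)"]) (auto simp: pw_closed)
qed auto

lemma inv_twist: "x \<in> carrier G \<Longrightarrow> inv\<^bsub>twist G s f\<^esub> x = pw (- f x) (inv x)"
proof -
  assume x: "x \<in> carrier G"
  have "pw (- f x) (inv x) \<otimes>\<^bsub>twist G s f\<^esub> x = \<one>"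
    using x pw_mult[of "inv x" x "- f x"] by (simp add: f_pw pw_one f_inv)
  then show ?thesis
    using x group.inv_equality[OF group_twist, of "pw (- f x) (inv x)" x] by (simp add: pw_closed)
qed

lemma subgroup_twist:
  assumes S: "subgroup S G" and inv: "s ` S \<subseteq> S"
  shows "subgroup S (twist G s f)"
proof -
  have pwS: "pw t x \<in> S" if "x \<in> S" for x t
    using that inv by (induct t rule: F3_induct) (simp_all add: twist_power_simps image_subset_iff)
  have sub: "x \<in> carrier G" if "x \<in> S" for x using S that by (rule subgroup.mem_carrier)
  show ?thesis
  proof (rule group.subgroupI[OF group_twist])
    show "S \<subseteq> carrier (twist G s f)" using sub by auto
    show "S \<noteq> {}" using subgroup.one_closed[OF S] by blast
    show "inv\<^bsub>twist G s f\<^esub> x \<in> S" if "x \<in> S" for x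
      using that S by (simp add: inv_twist sub pwS subgroup.m_inv_closed)
    show "x \<otimes>\<^bsub>twist G s f\<^esub> y \<in> S" if "x \<in> S" "y \<in> S" for x y
      using that S by (simp add: pwS subgroup.m_closed)
  qed
qed

text \<open>
  As \<open>D\<close> is invariant under \<open>s\<close>, the power of \<open>s\<close> that enters a translate of \<open>D\<close> in the twisted
  group only permutes \<open>D\<close>, so the intersection sizes of translates do not change.
\<close>

theorem difference_set_twist:
  assumes D: "difference_set G v k l D" and inv: "s ` D \<subseteq> D"
  shows "difference_set (twist G s f) v k l D"
proof -
  let ?T = "twist G s f"
  have fin: "finite (carrier G)" and sub: "D \<subseteq> carrier G" using D by (auto simp: difference_set_def)
  note G = difference_set_iff_translates[OF is_group fin sub]
  have "card {y \<in> D. g \<otimes>\<^bsub>?T\<^esub> y \<in> D} = card {y \<in> D. g \<otimes> y \<in> D}" for g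
  proof -
    have pwD: "pw t y \<in> D" if "y \<in> D" for y t
      using that inv by (induct t rule: F3_induct) (simp_all add: twist_power_simps image_subset_iff)
    have inverse: "pw (- t) (pw t y) = y" "pw t (pw (- t) y) = y" if "y \<in> D" for y t
      using pw_add[of y "- t" t] pw_add[of y t "- t"] that sub by (auto simp: twist_power_simps)
    have "bij_betw (pw (f g)) {y \<in> D. g \<otimes>\<^bsub>?T\<^esub> y \<in> D} {y \<in> D. g \<otimes> y \<in> D}"
      by (rule bij_betw_byWitness[where f' = "pw (- f g)"]) (auto simp: pwD inverse)
    then show ?thesis by (rule bij_betw_same_card)
  qed
  then show ?thesis
    using D fin sub difference_set_iff_translates[of ?T D] group_twist unfolding G by simp
qed

end

section \<open>Equivariant labellings of the points of projective space\<close>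

text \<open>
  The orbits have size one or three, and the number of fixed points determines how many there are
  of each size. The induction removes one orbit of size three from both sides.
\<close>

lemma order_three_conjugate:
  assumes "finite A" "finite B" "card A = card B"
    and s: "\<And>a. a \<in> A \<Longrightarrow> s a \<in> A" "\<And>a. a \<in> A \<Longrightarrow> s (s (s a)) = a"
    and t: "\<And>b. b \<in> B \<Longrightarrow> t b \<in> B" "\<And>b. b \<in> B \<Longrightarrow> t (t (t b)) = b"
    and fixed: "card {a \<in> A. s a = a} = card {b \<in> B. t b = b}"
  shows "\<exists>\<beta>. bij_betw \<beta> A B \<and> (\<forall>a\<in>A. \<beta> (s a) = t (\<beta> a))"
  using assms
proof (induction "card A" arbitrary: A B rule: less_induct)
  case less
  note finA = less.prems(1) and finB = less.prems(2) and cAB = less.prems(3)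
    and s = less.prems(4,5) and t = less.prems(6,7) and fixed = less.prems(8)
  show ?case
  proof (cases "\<forall>a\<in>A. s a = a")
    case True
    then have "{a \<in> A. s a = a} = A" by auto
    then have "{b \<in> B. t b = b} = B"
      using fixed cAB finB by (intro card_subset_eq) auto
    then have tid: "\<And>b. b \<in> B \<Longrightarrow> t b = b" by blast
    obtain \<beta> where "bij_betw \<beta> A B" using finite_same_card_bij finA finB cAB by blast
    then show ?thesis using True tid by (intro exI[of _ \<beta>]) (auto dest: bij_betwE)
  next
    case False
    then obtain a where a: "a \<in> A" "s a \<noteq> a" by blast
    have "\<exists>b\<in>B. t b \<noteq> b"
    proof (rule ccontr)
      assume "\<not> ?thesis"
      then have "{b \<in> B. t b = b} = B" by auto
      then have "{a \<in> A. s a = a} = A"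
        using fixed cAB finA by (intro card_subset_eq) auto
      then show False using a by blast
    qed
    then obtain b where b: "b \<in> B" "t b \<noteq> b" by blast
    let ?A = "A - {a, s a, s (s a)}" and ?B = "B - {b, t b, t (t b)}"
    have dA: "s (s a) \<noteq> a" "s (s a) \<noteq> s a" using a s by metis+
    have dB: "t (t b) \<noteq> b" "t (t b) \<noteq> t b" using b t by metis+
    have oA: "{a, s a, s (s a)} \<subseteq> A" "card {a, s a, s (s a)} = 3" using a dA s by auto
    have oB: "{b, t b, t (t b)} \<subseteq> B" "card {b, t b, t (t b)} = 3" using b dB t by auto
    have cA: "card ?A = card A - 3" using oA finA by (subst card_Diff_subset) auto
    have cB: "card ?B = card B - 3" using oB finB by (subst card_Diff_subset) auto
    have lt: "card ?A < card A" using a finA by (intro psubset_card_mono) auto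
    have sA: "s x \<in> ?A" if "x \<in> ?A" for x
    proof -
      have "s x = y \<Longrightarrow> x = s (s y)" for y using s that by auto
      then have "s x \<noteq> a" "s x \<noteq> s a" "s x \<noteq> s (s a)" using that s a by fastforce+
      then show ?thesis using that s by auto
    qed
    have tB: "t x \<in> ?B" if "x \<in> ?B" for x
    proof -
      have "t x = y \<Longrightarrow> x = t (t y)" for y using t that by auto
      then have "t x \<noteq> b" "t x \<noteq> t b" "t x \<noteq> t (t b)" using that t b by fastforce+
      then show ?thesis using that t by auto
    qed
    have "{x \<in> ?A. s x = x} = {x \<in> A. s x = x}" using a dA s(2)[OF a(1)] by auto
    moreover have "{x \<in> ?B. t x = x} = {x \<in> B. t x = x}" using b dB t(2)[OF b(1)] by auto
    ultimately have fixed': "card {x \<in> ?A. s x = x} = card {x \<in> ?B. t x = x}" using fixed by simp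
    have "\<exists>\<beta>. bij_betw \<beta> ?A ?B \<and> (\<forall>x\<in>?A. \<beta> (s x) = t (\<beta> x))"
    proof (rule less.hyps[OF lt _ _ _ sA _ tB _ fixed'])
      show "finite ?A" "finite ?B" using finA finB by auto
      show "card ?A = card ?B" using cA cB cAB by simp
      show "s (s (s x)) = x" if "x \<in> ?A" for x using s(2) that by blast
      show "t (t (t x)) = x" if "x \<in> ?B" for x using t(2) that by blast
    qed
    then obtain \<beta> where \<beta>: "bij_betw \<beta> ?A ?B" "\<And>x. x \<in> ?A \<Longrightarrow> \<beta> (s x) = t (\<beta> x)" by blast
    define \<gamma> where "\<gamma> x = (if x = a then b else if x = s a then t b else if x = s (s a) then t (t b) else \<beta> x)" for x
    have \<gamma>a: "\<gamma> a = b" "\<gamma> (s a) = t b" "\<gamma> (s (s a)) = t (t b)"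
      using a dA by (auto simp: \<gamma>_def)
    have \<gamma>\<beta>: "\<gamma> x = \<beta> x" if "x \<in> ?A" for x using that by (auto simp: \<gamma>_def)
    have "bij_betw \<gamma> ?A ?B" using \<beta>(1) bij_betw_cong[of ?A \<gamma> \<beta> ?B] \<gamma>\<beta> by blast
    moreover have "bij_betw \<gamma> {a, s a, s (s a)} {b, t b, t (t b)}"
      unfolding bij_betw_def inj_on_def using \<gamma>a b dB by auto
    ultimately have "bij_betw \<gamma> (?A \<union> {a, s a, s (s a)}) (?B \<union> {b, t b, t (t b)})"
      by (rule bij_betw_combine) auto
    moreover have "?A \<union> {a, s a, s (s a)} = A" "?B \<union> {b, t b, t (t b)} = B" using oA oB by auto
    ultimately have bij: "bij_betw \<gamma> A B" by simp
    have "\<gamma> (s x) = t (\<gamma> x)" if "x \<in> A" for x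
    proof (cases "x \<in> ?A")
      case True
      then show ?thesis using \<gamma>\<beta> sA \<beta>(2) by auto
    next
      case False
      then have "x = a \<or> x = s a \<or> x = s (s a)" using that by auto
      then show ?thesis using \<gamma>a s(2)[OF a(1)] t(2)[OF b(1)] by auto
    qed
    then show ?thesis using bij by blast
  qed
qed

text \<open>
  An arbitrary choice of representatives need not be compatible with an automorphism, so the
  equivariant bijection is built with the pairs \<open>{u, - u}\<close> themselves.
\<close>

definition points :: "'i set \<Rightarrow> ('i \<Rightarrow> 3) set set" where
  "points I = (\<lambda>u. {u, - u}) ` (vecs I - {0})"

definition rep :: "('i \<Rightarrow> 3) set \<Rightarrow> 'i \<Rightarrow> 3" where
  "rep L = (SOME u. u \<in> L)"

lemma rep:
  assumes "L \<in> points I"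
  shows "rep L \<in> vecs I" "rep L \<noteq> 0" "L = {rep L, - rep L}"
proof -
  obtain u where u: "u \<in> vecs I" "u \<noteq> 0" "L = {u, - u}" using assms by (auto simp: points_def)
  then have "rep L \<in> L" unfolding rep_def by (intro someI[of "\<lambda>v. v \<in> L" u]) simp
  then show "rep L \<in> vecs I" "rep L \<noteq> 0" "L = {rep L, - rep L}" using u by auto
qed

lemma half_system_points:
  assumes b: "bij_betw \<beta> A (points I)"
  shows "half_system I A (rep \<circ> \<beta>)"
  unfolding half_system_def
proof (intro conjI ballI)
  have \<beta>: "\<beta> k \<in> points I" if "k \<in> A" for k using b that by (rule bij_betw_apply)
  show "(rep \<circ> \<beta>) k \<in> vecs I" "(rep \<circ> \<beta>) k \<noteq> 0" if "k \<in> A" for k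
    using rep(1,2)[OF \<beta>[OF that]] by simp_all
  fix u assume u: "u \<in> vecs I - {0}"
  then have "{u, - u} \<in> points I" by (simp add: points_def)
  then obtain k where k: "k \<in> A" "\<beta> k = {u, - u}" using b unfolding bij_betw_def by (metis imageE)
  have iff: "(rep (\<beta> l) = u \<or> rep (\<beta> l) = - u) \<longleftrightarrow> \<beta> l = {u, - u}" if "l \<in> A" for l
  proof -
    have "v = u \<or> v = - u \<longleftrightarrow> {v, - v} = {u, - u}" for v by (auto simp: doubleton_eq_iff)
    then show ?thesis using rep(3)[OF \<beta>[OF that]] by metis
  qed
  show "\<exists>!k. k \<in> A \<and> ((rep \<circ> \<beta>) k = u \<or> (rep \<circ> \<beta>) k = - u)"
  proof (rule ex1I)
    show "k \<in> A \<and> ((rep \<circ> \<beta>) k = u \<or> (rep \<circ> \<beta>) k = - u)"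
      using k iff[OF k(1)] unfolding comp_apply by blast
    fix l assume "l \<in> A \<and> ((rep \<circ> \<beta>) l = u \<or> (rep \<circ> \<beta>) l = - u)"
    then have l: "l \<in> A" "rep (\<beta> l) = u \<or> rep (\<beta> l) = - u" unfolding comp_apply by blast+
    then have "\<beta> l = \<beta> k" using iff[OF l(1)] k(2) by metis
    then show "l = k" using b k l by (meson bij_betw_imp_inj_on inj_onD)
  qed
qed

text \<open>
  The coordinate set, with a residue modulo 3 as the position inside a block. Rotating the position
  is then a translation, so that no case distinction arises at the end of a block.
\<close>

definition blocks :: "nat \<Rightarrow> (nat \<times> 3) set" where
  "blocks d = {..<d} \<times> UNIV"

definition rot :: "(nat \<times> 3 \<Rightarrow> 3) \<Rightarrow> nat \<times> 3 \<Rightarrow> 3" where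
  "rot x = (\<lambda>(i, j). x (i, j + 1))"

lemma blocks: "finite (blocks d)" "card (blocks d) = 3 * d"
  by (simp_all add: blocks_def card_cartesian_product)

lemma rot_apply [simp]: "rot x (i, j) = x (i, j + 1)"
  by (simp add: rot_def)

lemma rot_vecs [simp]: "x \<in> vecs (blocks d) \<Longrightarrow> rot x \<in> vecs (blocks d)"
  by (auto simp: vecs_def blocks_def)

lemma rot_simps [simp]:
  "rot 0 = 0" "rot (x + y) = rot x + rot y" "rot (- x) = - rot x" "rot (rot (rot x)) = x"
proof -
  have period: "3 + j = j" for j :: 3 by (induct j rule: F3_induct) simp_all
  show "rot (rot (rot x)) = x" by (simp add: fun_eq_iff rot_def period split: prod.splits)
qed (auto simp: fun_eq_iff)

lemma rot_eq_iff: "rot x = rot y \<longleftrightarrow> x = y"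
  by (metis rot_simps(4))

text \<open>
  The two vector arguments and the arbitrary \<open>g\<close> cover both the invariance of the scalar product
  and that of the coordinate sum.
\<close>

lemma sum_rot: "(\<Sum>p\<in>blocks d. g (rot x p) (rot y p)) = (\<Sum>p\<in>blocks d. g (x p) (y p))"
proof -
  have "bij_betw (\<lambda>(i, j). (i, j + 1)) (blocks d) (blocks d)"
    by (rule bij_betw_byWitness[where f' = "\<lambda>(i, j). (i, j - 1)"]) (auto simp: blocks_def)
  from sum.reindex_bij_betw[OF this, of "\<lambda>p. g (x p) (y p)"]
  show ?thesis by (simp add: rot_def case_prod_beta)
qed

lemma dot_rot [simp]: "dot (blocks d) (rot u) (rot x) = dot (blocks d) u x"
  unfolding dot_def by (rule sum_rot)

text \<open>
  A fixed vector is constant on each block.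
\<close>

lemma card_fixed_vecs: "card {u \<in> vecs (blocks d). rot u = u} = 3 ^ d"
proof -
  have const: "u (i, j) = u (i, 0)" if "rot u = u" for u i j
  proof -
    have "rot u (i, k) = u (i, k)" for k using that by simp
    from this[of 0] this[of 1] show ?thesis by (induct j rule: F3_induct) simp_all
  qed
  have "bij_betw (\<lambda>u i. u (i, 0)) {u \<in> vecs (blocks d). rot u = u} (vecs {..<d})"
  proof (rule bij_betw_byWitness[where f' = "\<lambda>y (i, j). y i"])
    show "\<forall>u\<in>{u \<in> vecs (blocks d). rot u = u}. (\<lambda>(i, j). u (i, 0)) = u"
    proof (intro ballI ext)
      fix u p assume "u \<in> {u \<in> vecs (blocks d). rot u = u}"
      then have "rot u = u" by simp
      then show "(case p of (i, j) \<Rightarrow> u (i, 0)) = u p"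
        using const[of u "fst p" "snd p"] by (simp only: case_prod_beta prod.collapse)
    qed
  qed (auto simp: vecs_def blocks_def fun_eq_iff)
  from bij_betw_same_card[OF this] show ?thesis by (simp add: card_vecs)
qed

lemma rot_points: "L \<in> points (blocks d) \<Longrightarrow> rot ` L \<in> points (blocks d)"
proof -
  assume "L \<in> points (blocks d)"
  then obtain u where u: "u \<in> vecs (blocks d)" "u \<noteq> 0" "L = {u, - u}" by (auto simp: points_def)
  have "rot u \<noteq> 0" using u(2) rot_eq_iff[of u 0] unfolding rot_simps(1) by blast
  moreover have "rot ` L = {rot u, - rot u}" using u(3) by simp
  ultimately show ?thesis unfolding points_def using rot_vecs[OF u(1)] by blast
qed

text \<open>
  The rotation cannot exchange \<open>u\<close> and \<open>- u\<close>, because three applications of it give \<open>u\<close> back and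
  \<open>u = - u\<close> holds for the zero vector only.
\<close>

lemma rot_fixes_point_iff:
  assumes "L \<in> points (blocks d)"
  shows "rot ` L = L \<longleftrightarrow> rot (rep L) = rep L"
proof
  assume "rot (rep L) = rep L"
  then show "rot ` L = L" by (subst (1 2) rep(3)[OF assms]) simp
next
  assume "rot ` L = L"
  then have "rot (rep L) \<in> {rep L, - rep L}" using rep(3)[OF assms] by blast
  moreover have "rot (rep L) \<noteq> - rep L"
  proof
    assume "rot (rep L) = - rep L"
    then have "rot (rot (rot (rep L))) = - rep L" by simp
    then show False using vecs_neg_eq_iff[of "rep L"] rep(2)[OF assms] by simp
  qed
  ultimately show "rot (rep L) = rep L" by blast
qed

lemma card_points:
  "finite (points (blocks d))" "2 * card (points (blocks d)) + 1 = 27 ^ d"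
  "2 * card {L \<in> points (blocks d). rot ` L = L} + 1 = 3 ^ d"
proof -
  let ?P = "points (blocks d)" and ?V = "vecs (blocks d)"
  note fin = card_vecs(1)[OF blocks(1)[of d]]
  show "finite ?P" using fin by (simp add: points_def)
  have h: "half_system (blocks d) ?P rep" using half_system_points[of id ?P] by simp
  show "2 * card ?P + 1 = 27 ^ d"
    using half_system_card[OF h blocks(1)] blocks(2) by (simp add: power_mult)
  let ?U = "{u \<in> ?V. rot u = u}"
  have "card (?U - {0}) = 2 * card {L \<in> ?P. rep L \<in> ?U - {0}}"
    by (rule half_system_count[OF h blocks(1)]) auto
  also have "{L \<in> ?P. rep L \<in> ?U - {0}} = {L \<in> ?P. rot ` L = L}"
    using rep(1,2) rot_fixes_point_iff by blast
  finally have "card (?U - {0}) = 2 * card {L \<in> ?P. rot ` L = L}" .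
  moreover have "card ?U = Suc (card (?U - {0}))"
    by (rule card.remove) (use fin in auto)
  ultimately show "2 * card {L \<in> ?P. rot ` L = L} + 1 = 3 ^ d"
    using card_fixed_vecs[of d] by linarith
qed

definition hyperplane_number :: "nat \<Rightarrow> nat" where
  "hyperplane_number d = (27 ^ d - 1) div 2"

definition mult_pow3 :: "nat \<Rightarrow> int \<Rightarrow> int" where
  "mult_pow3 d k = (3 ^ d * k) mod int (hyperplane_number d)"

lemma hyperplane_number: "2 * hyperplane_number d + 1 = 27 ^ d"
proof -
  have "odd (27 ^ d :: nat)" by simp
  then show ?thesis unfolding hyperplane_number_def by (auto elim!: oddE)
qed

lemma hyperplane_number_gt: "d \<ge> 1 \<Longrightarrow> 3 ^ d < hyperplane_number d"
proof -
  assume "d \<ge> 1"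
  then have "(3::nat) ^ 1 \<le> 3 ^ d" by (rule power_increasing) simp
  then have m: "(3::nat) \<le> 3 ^ d" by simp
  have "(27::nat) ^ d = 3 ^ d * (3 ^ d * 3 ^ d)"
    by (simp add: power_mult_distrib[symmetric])
  moreover have "3 ^ d * (3 * 3) \<le> (3::nat) ^ d * (3 ^ d * 3 ^ d)" using m by (intro mult_le_mono) auto
  ultimately show ?thesis using hyperplane_number[of d] m by linarith
qed

text \<open>
  With \<open>m = 3^d\<close> this is \<open>(m^3 - 1) / 2 = ((m - 1) / 2) (m^2 + m + 1)\<close>, where the second factor is
  written as a polynomial in \<open>a = (m - 1) / 2\<close> to avoid subtraction.
\<close>

lemma hyperplane_number_factor:
  obtains a b :: nat where "hyperplane_number d = a * b" "2 * a + 1 = 3 ^ d" "odd b"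
proof -
  have "odd (3 ^ d :: nat)" by simp
  then obtain a where a: "(3::nat) ^ d = 2 * a + 1" by (rule oddE)
  define b :: nat where "b = 4 * a * a + 6 * a + 3"
  have "(27::nat) ^ d = 3 ^ d * 3 ^ d * 3 ^ d" by (simp add: power_mult_distrib[symmetric])
  also have "\<dots> = 2 * (a * b) + 1" unfolding a b_def by (simp add: algebra_simps)
  finally have "hyperplane_number d = a * b" using hyperplane_number[of d] by linarith
  moreover have "odd b" by (simp add: b_def)
  ultimately show ?thesis using that a by metis
qed

lemma mult_pow3_simps:
  assumes "d \<ge> 1"
  shows "mult_pow3 d 0 = 0" "mult_pow3 d k \<in> {0..<int (hyperplane_number d)}"
    "mult_pow3 d ((k + l) mod int (hyperplane_number d)) = (mult_pow3 d k + mult_pow3 d l) mod int (hyperplane_number d)"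
    "k \<in> {0..<int (hyperplane_number d)} \<Longrightarrow> mult_pow3 d (mult_pow3 d (mult_pow3 d k)) = k"
proof -
  let ?r = "int (hyperplane_number d)"
  have r: "?r > 0" using hyperplane_number_gt[OF assms] by linarith
  show "mult_pow3 d 0 = 0" by (simp add: mult_pow3_def)
  show "mult_pow3 d k \<in> {0..<?r}" using r by (simp add: mult_pow3_def)
  show "mult_pow3 d ((k + l) mod ?r) = (mult_pow3 d k + mult_pow3 d l) mod ?r"
    by (simp add: mult_pow3_def mod_simps distrib_left)
  assume k: "k \<in> {0..<?r}"
  have "int (27 ^ d) = 2 * ?r + 1" unfolding hyperplane_number[symmetric] by simp
  moreover have "(27::int) ^ d = 3 ^ d * (3 ^ d * 3 ^ d)" by (simp add: power_mult_distrib[symmetric])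
  ultimately have "3 ^ d * (3 ^ d * (3 ^ d * k)) = k + ?r * (2 * k)"
    by (simp add: algebra_simps)
  then show "mult_pow3 d (mult_pow3 d (mult_pow3 d k)) = k" using k by (simp add: mult_pow3_def mod_simps)
qed

text \<open>
  With \<open>m = 3^d\<close> and \<open>r = a b\<close> as in the factorisation above, \<open>k\<close> is fixed if and only if \<open>a b\<close>
  divides \<open>(m - 1) k = 2 a k\<close>. As \<open>b\<close> is odd, this means that \<open>b\<close> divides \<open>k\<close>, which leaves \<open>a\<close>
  residues.
\<close>

lemma card_fixed_mult_pow3:
  assumes "d \<ge> 1"
  shows "2 * card {k \<in> {0..<int (hyperplane_number d)}. mult_pow3 d k = k} + 1 = 3 ^ d"
proof -
  obtain a b :: nat where ab: "hyperplane_number d = a * b" "2 * a + 1 = 3 ^ d" "odd b"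
    by (rule hyperplane_number_factor)
  have pos: "a > 0" "b > 0" using hyperplane_number_gt[OF assms] ab(1) by (auto intro: ccontr)
  have m: "(3::int) ^ d = 2 * int a + 1" using ab(2) by (metis of_nat_1 of_nat_add of_nat_mult of_nat_numeral of_nat_power)
  have "mult_pow3 d k = k \<longleftrightarrow> int b dvd k" if k: "k \<in> {0..<int (hyperplane_number d)}" for k
  proof -
    have "mult_pow3 d k = k \<longleftrightarrow> (3 ^ d * k) mod int (hyperplane_number d) = k mod int (hyperplane_number d)"
      using k by (simp add: mult_pow3_def)
    also have "\<dots> \<longleftrightarrow> int a * int b dvd int a * (2 * k)"
      unfolding mod_eq_dvd_iff m ab(1) by (simp add: algebra_simps)
    also have "\<dots> \<longleftrightarrow> int b dvd 2 * k" using pos by simp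
    also have "\<dots> \<longleftrightarrow> int b dvd k"
      using ab(3) by (intro coprime_dvd_mult_right_iff) simp
    finally show ?thesis .
  qed
  then have "{k \<in> {0..<int (hyperplane_number d)}. mult_pow3 d k = k} = (\<lambda>j. int b * j) ` {0..<int a}"
    using pos unfolding ab(1) by (auto simp: zero_le_mult_iff image_iff elim!: dvdE)
  then have "card {k \<in> {0..<int (hyperplane_number d)}. mult_pow3 d k = k} = a"
    using pos by (simp add: card_image inj_on_def)
  then show ?thesis using ab by simp
qed

text \<open>
  Equivariance up to sign is enough for the Spence set of \<open>h\<close> to be invariant, because a linear form
  and its negative have the same kernel.
\<close>

lemma equivariant_half_system:
  assumes d: "d \<ge> 1"
  obtains h where "half_system (blocks d) {0..<int (hyperplane_number d)} h"
    "\<And>k. k \<in> {0..<int (hyperplane_number d)} \<Longrightarrow> h (mult_pow3 d k) = rot (h k) \<or> h (mult_pow3 d k) = - rot (h k)"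
proof -
  let ?A = "{0..<int (hyperplane_number d)}" and ?P = "points (blocks d)"
  have "\<exists>\<beta>. bij_betw \<beta> ?A ?P \<and> (\<forall>k\<in>?A. \<beta> (mult_pow3 d k) = rot ` \<beta> k)"
  proof (rule order_three_conjugate)
    show "finite ?A" "finite ?P" using card_points by auto
    show "card ?A = card ?P" using card_points(2)[of d] hyperplane_number[of d] by simp
    show "card {k \<in> ?A. mult_pow3 d k = k} = card {L \<in> ?P. rot ` L = L}"
      using card_points(3)[of d] card_fixed_mult_pow3[OF d] by linarith
  qed (use mult_pow3_simps[OF d] rot_points in \<open>auto simp: image_image\<close>)
  then obtain \<beta> where \<beta>: "bij_betw \<beta> ?A ?P" "\<And>k. k \<in> ?A \<Longrightarrow> \<beta> (mult_pow3 d k) = rot ` \<beta> k" by blast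
  show thesis
  proof (rule that[OF half_system_points[OF \<beta>(1)]])
    fix k assume k: "k \<in> ?A"
    have P: "\<beta> k \<in> ?P" "\<beta> (mult_pow3 d k) \<in> ?P"
      using bij_betw_apply[OF \<beta>(1)] k mult_pow3_simps(2)[OF d] by blast+
    have "rep (\<beta> (mult_pow3 d k)) \<in> rot ` {rep (\<beta> k), - rep (\<beta> k)}"
      using rep(3)[OF P(1)] rep(3)[OF P(2)] \<beta>(2)[OF k] by blast
    then show "(rep \<circ> \<beta>) (mult_pow3 d k) = rot ((rep \<circ> \<beta>) k) \<or> (rep \<circ> \<beta>) (mult_pow3 d k) = - rot ((rep \<circ> \<beta>) k)"
      by auto
  qed
qed

section \<open>Nonabelian, non-normal Sylow subgroups\<close>

text \<open>
  A finite group can be copied to the natural numbers along any injection. Failure of commutativity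
  and of normality enter through witnesses, which are easy to carry over.
\<close>

lemma transport_to_nat:
  fixes G :: "('a, 'b) monoid_scheme"
  assumes G: "group G" "finite (carrier G)" and P: "sylow_subgroup p P G"
    and D: "difference_set G v k l D"
    and nonabelian: "a \<in> P" "b \<in> P" "a \<otimes>\<^bsub>G\<^esub> b \<noteq> b \<otimes>\<^bsub>G\<^esub> a"
    and nonnormal: "g \<in> carrier G" "c \<in> P" "g \<otimes>\<^bsub>G\<^esub> c \<otimes>\<^bsub>G\<^esub> inv\<^bsub>G\<^esub> g \<notin> P"
  shows "\<exists>(H :: nat monoid) Q E. group H \<and> sylow_subgroup p Q H \<and>
     \<not> comm_group (H\<lparr>carrier := Q\<rparr>) \<and> \<not> Q \<lhd> H \<and> difference_set H v k l E"
proof -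
  interpret G: group G by fact
  obtain \<phi> :: "'a \<Rightarrow> nat" where inj: "inj_on \<phi> (carrier G)"
    using finite_imp_inj_to_nat_seg[OF G(2)] by blast
  define H where "H = image_group \<phi> G"
  have iso: "\<phi> \<in> iso G H" unfolding H_def by (rule inj_imp_image_group_iso[OF inj])
  have H: "group H" unfolding H_def by (rule G.inj_imp_image_group_is_group[OF inj])
  interpret H: group H by fact
  interpret \<phi>: group_hom G H \<phi> using iso by unfold_locales (simp add: iso_def)
  have cH: "carrier H = \<phi> ` carrier G" by (simp add: H_def image_group_carrier)
  have oH: "order H = order G" unfolding order_def cH using inj by (rule card_image)
  have finH: "finite (carrier H)" using G cH by simp
  have sub: "subgroup P G" "P \<subseteq> carrier G" using P by (auto simp: sylow_subgroup_def dest: subgroup.subset)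
  have DG: "D \<subseteq> carrier G" using D by (simp add: difference_set_def)
  have mem: "\<phi> x \<in> \<phi> ` S \<longleftrightarrow> x \<in> S" if "x \<in> carrier G" "S \<subseteq> carrier G" for x S
    using inj that by (meson inj_on_image_mem_iff)
  have c: "c \<in> carrier G" using nonnormal(2) sub(2) by blast
  have "sylow_subgroup p (\<phi> ` P) H"
    using P H finH oH \<phi>.subgroup_img_is_subgroup[OF sub(1)] card_image[OF inj_on_subset[OF inj sub(2)]]
    by (simp add: sylow_subgroup_def)
  moreover have "\<not> comm_group (H\<lparr>carrier := \<phi> ` P\<rparr>)"
  proof
    assume "comm_group (H\<lparr>carrier := \<phi> ` P\<rparr>)"
    then have "\<phi> a \<otimes>\<^bsub>H\<^esub> \<phi> b = \<phi> b \<otimes>\<^bsub>H\<^esub> \<phi> a"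
      using comm_groupE(4)[of "H\<lparr>carrier := \<phi> ` P\<rparr>" "\<phi> a" "\<phi> b"] nonabelian by simp
    then have "\<phi> (a \<otimes>\<^bsub>G\<^esub> b) = \<phi> (b \<otimes>\<^bsub>G\<^esub> a)" using nonabelian sub by (simp add: subset_iff)
    then show False using nonabelian sub inj by (auto simp: inj_on_def subset_iff)
  qed
  moreover have "\<not> \<phi> ` P \<lhd> H"
  proof
    assume "\<phi> ` P \<lhd> H"
    then have "\<forall>x\<in>carrier H. \<forall>y\<in>\<phi> ` P. x \<otimes>\<^bsub>H\<^esub> y \<otimes>\<^bsub>H\<^esub> inv\<^bsub>H\<^esub> x \<in> \<phi> ` P"
      unfolding H.normal_inv_iff by (rule conjunct2)
    from this[rule_format, OF \<phi>.hom_closed[OF nonnormal(1)] imageI[OF nonnormal(2)]]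
    have "\<phi> (g \<otimes>\<^bsub>G\<^esub> c \<otimes>\<^bsub>G\<^esub> inv\<^bsub>G\<^esub> g) \<in> \<phi> ` P"
      using nonnormal(1) c by (simp only: \<phi>.hom_mult \<phi>.hom_inv G.m_closed G.inv_closed)
    then show False using nonnormal(1,3) c sub(2) mem by (meson G.m_closed G.inv_closed)
  qed
  moreover have "difference_set H v k l (\<phi> ` D)"
  proof -
    have DH: "\<phi> ` D \<subseteq> carrier H" using DG cH by auto
    have "card {y \<in> \<phi> ` D. \<phi> x \<otimes>\<^bsub>H\<^esub> y \<in> \<phi> ` D} = card {y \<in> D. x \<otimes>\<^bsub>G\<^esub> y \<in> D}" if x: "x \<in> carrier G" for x
    proof -
      have *: "\<phi> x \<otimes>\<^bsub>H\<^esub> \<phi> y \<in> \<phi> ` D \<longleftrightarrow> x \<otimes>\<^bsub>G\<^esub> y \<in> D" if "y \<in> D" for y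
        using x that DG mem[of "x \<otimes>\<^bsub>G\<^esub> y" D] by (simp add: subset_iff)
      then have "{y \<in> \<phi> ` D. \<phi> x \<otimes>\<^bsub>H\<^esub> y \<in> \<phi> ` D} = \<phi> ` {y \<in> D. x \<otimes>\<^bsub>G\<^esub> y \<in> D}" by auto
      then show ?thesis using inj_on_subset[OF inj] DG by (simp add: card_image subset_iff)
    qed
    moreover have "card (\<phi> ` D) = card D" using inj_on_subset[OF inj DG] by (rule card_image)
    ultimately show ?thesis
      using D oH difference_set_iff_translates[OF H finH DH] difference_set_iff_translates[OF G DG]
      unfolding cH by (auto simp: \<phi>.hom_one[symmetric] simp del: \<phi>.hom_one)
  qed
  ultimately show ?thesis using H by blast
qed

theorem theorem5p1:
  fixes d :: nat
  assumes "d \<ge> 1"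
  shows "\<exists>(G :: nat monoid) P D.
           group G \<and>
           sylow_subgroup 3 P G \<and>
           \<not> comm_group (G\<lparr>carrier := P\<rparr>) \<and>
           \<not> P \<lhd> G \<and>
           difference_set G (spence_v d) (spence_k d) (spence_lambda d) D"
proof -
  let ?I = "blocks d" and ?r = "hyperplane_number d"
  define K where "K = integer_mod_group ?r"
  define G where "G = vec_group ?I \<times>\<times> K"
  define s where "s = map_prod rot (mult_pow3 d)"
  define f where "f = (\<lambda>(x, k :: int). \<Sum>p\<in>?I. x p :: 3)"
  have m: "(1::nat) < 3 ^ d" using assms by (intro one_less_power) auto
  then have r: "3 ^ d < ?r" "1 < ?r" "?r > 0" using hyperplane_number_gt[OF assms] by linarith+
  have cK: "carrier K = {0..<int ?r}" and K: "group K" and oneK: "\<one>\<^bsub>K\<^esub> = 0"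
    and multK: "\<And>k l. k \<otimes>\<^bsub>K\<^esub> l = (k + l) mod int ?r"
    using r by (simp_all add: K_def carrier_integer_mod_group)
  note mul = mult_pow3_simps[OF assms]
  obtain h where h: "half_system ?I (carrier K) h"
    and equi: "\<And>k. k \<in> carrier K \<Longrightarrow> h (mult_pow3 d k) = rot (h k) \<or> h (mult_pow3 d k) = - rot (h k)"
    unfolding cK using equivariant_half_system[OF assms] by blast
  let ?D = "spence_set ?I K h"
  have spence: "difference_set G (spence_v d) (spence_k d) (spence_lambda d) ?D"
  proof -
    have n: "Suc (3 * d - 1) = 3 * d" using assms by simp
    have p: "(3::nat) ^ (3 * d) = 2 * ?r + 1" using hyperplane_number[of d] by (simp add: power_mult)
    have "difference_set G (3 ^ (3 * d) * card (carrier K))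
        (3 ^ (3 * d - 1) * (card (carrier K) + 1)) (3 ^ (3 * d - 1) * (3 ^ (3 * d - 1) + 1) div 2) ?D"
      using spence_difference_set[OF K _ h, of "3 * d - 1"] blocks n cK unfolding G_def by simp
    moreover have "spence_v d = 3 ^ (3 * d) * card (carrier K)"
      unfolding spence_v_def p cK by simp
    moreover have "spence_k d = 3 ^ (3 * d - 1) * (card (carrier K) + 1)"
      unfolding spence_k_def p cK by (simp add: div_mult_swap)
    ultimately show ?thesis by (simp add: spence_lambda_def)
  qed
  have G: "group G" unfolding G_def by (rule DirProd_group[OF vec_group K])
  interpret twisting G s f
  proof (intro twisting.intro G twisting_axioms.intro)
    show "s \<in> hom G G" using mul
      by (auto simp: hom_def G_def s_def multK cK mult_DirProd')
    show "s (s (s x)) = x" if "x \<in> carrier G" for x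
      using that mul by (auto simp: G_def s_def cK)
    show "f (x \<otimes>\<^bsub>G\<^esub> y) = f x + f y" for x y
      by (simp add: f_def G_def mult_DirProd' case_prod_beta sum.distrib)
    show "f (s x) = f x" for x
      using sum_rot[of "\<lambda>a b. a"] by (simp add: f_def s_def case_prod_beta)
  qed
  let ?T = "twist G s f"
  have "s ` ?D \<subseteq> ?D"
  proof (rule image_subsetI)
    fix z assume "z \<in> ?D"
    moreover obtain x k where z: "z = (x, k)" by (cases z)
    ultimately have xk: "(x, k) \<in> ?D" by simp
    then have k: "k \<in> carrier K" by (simp add: spence_set_def)
    have "mult_pow3 d k = 0 \<longleftrightarrow> k = 0" using mul(1) mul(4)[of k] k cK by metis
    moreover have "dot ?I (h (mult_pow3 d k)) (rot x) = 0 \<longleftrightarrow> dot ?I (h k) x = 0"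
      using equi[OF k] by auto
    ultimately show "s z \<in> ?D" unfolding z using xk mul(2) by (simp add: spence_set_def s_def cK oneK)
  qed
  then have D: "difference_set ?T (spence_v d) (spence_k d) (spence_lambda d) ?D"
    by (rule difference_set_twist[OF spence])
  let ?P = "vecs ?I \<times> {0 :: int}"
  have fin: "finite (carrier ?T)" using card_vecs[OF blocks(1)] by (simp add: G_def cK)
  have sylow: "sylow_subgroup 3 ?P ?T"
  proof -
    have "subgroup ?P G"
      unfolding G_def oneK[symmetric]
      using DirProd_subgroups[OF vec_group group.subgroup_self[OF vec_group] K group.triv_subgroup[OF K]] by simp
    then have sub: "subgroup ?P ?T"
      by (rule subgroup_twist) (auto simp: s_def mul)
    have "\<not> 3 dvd ?r"
    proof
      assume "3 dvd ?r"
      moreover have "3 dvd (27::nat) ^ d" using assms by (cases d) (auto intro: dvd_mult2)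
      ultimately show False using hyperplane_number[of d] by presburger
    qed
    moreover have "order ?T = 3 ^ (3 * d) * ?r"
      using card_vecs[OF blocks(1)] blocks(2) by (simp add: order_def G_def cK card_cartesian_product)
    ultimately have "multiplicity 3 (order ?T) = 3 * d"
      by (intro multiplicity_decomposeI) auto
    then show ?thesis using sub group_twist fin card_vecs[OF blocks(1)] blocks(2)
      by (simp add: sylow_subgroup_def card_cartesian_product)
  qed
  \<comment> \<open>Two vectors supported on the first block: \<open>x\<close> has coordinate sum 1, and \<open>y\<close> has coordinate sum 0
    but is not fixed by the rotation.\<close>
  have base: "(0, 0) \<in> ?I" "(0, 1) \<in> ?I" using assms by (auto simp: blocks_def)
  define x :: "nat \<times> 3 \<Rightarrow> 3" where "x = (\<lambda>p. if p = (0, 0) then 1 else 0 :: 3)"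
  define y :: "nat \<times> 3 \<Rightarrow> 3" where "y = (\<lambda>p. if p = (0, 0) then 1 else if p = (0, 1) then 2 else 0 :: 3)"
  have xy: "x \<in> vecs ?I" "y \<in> vecs ?I" using base by (auto simp: x_def y_def vecs_def)
  have fx: "f (x, k) = 1" for k using base blocks by (simp add: f_def x_def)
  have fy: "f (y, k) = 0" for k
  proof -
    have "y = (\<lambda>p. (if p = (0, 0) then 1 else 0) + (if p = (0, 1) then 2 else 0))"
      by (auto simp: y_def)
    then show ?thesis using base blocks by (simp add: f_def sum.distrib)
  qed
  have nonabelian: "(x, 0) \<otimes>\<^bsub>?T\<^esub> (y, 0) \<noteq> (y, 0) \<otimes>\<^bsub>?T\<^esub> (x, 0)"
  proof
    assume "(x, 0) \<otimes>\<^bsub>?T\<^esub> (y, 0) = (y, 0) \<otimes>\<^bsub>?T\<^esub> (x, 0)"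
    then have "x + rot y = y + x"
      by (simp add: fx fy twist_power_simps s_def G_def)
    then have "rot y (0, 0) = y (0, 0)" by (simp add: add.commute)
    then show False by (simp add: y_def)
  qed
  have g: "(0, 1) \<in> carrier ?T" using r by (simp add: G_def cK)
  have nonnormal: "(0, 1) \<otimes>\<^bsub>?T\<^esub> (x, 0) \<otimes>\<^bsub>?T\<^esub> inv\<^bsub>?T\<^esub> (0, 1) \<notin> ?P"
  proof
    interpret T: group ?T by (rule group_twist)
    let ?z = "(0, 1) \<otimes>\<^bsub>?T\<^esub> (x, 0) \<otimes>\<^bsub>?T\<^esub> inv\<^bsub>?T\<^esub> (0, 1)"
    assume "?z \<in> ?P"
    then obtain w where w: "?z = (w, 0)" by auto
    have xT: "(x, 0) \<in> carrier ?T" using xy r by (simp add: G_def cK)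
    \<comment> \<open>If the conjugate were \<open>(w, 0)\<close>, comparing first components would give \<open>w = x\<close>. Then \<open>w\<close> acts as
      \<open>s\<close>, so the second components would show that \<open>mult_pow3 d\<close> fixes 1.\<close>
    have "?z \<otimes>\<^bsub>?T\<^esub> (0, 1) = (0, 1) \<otimes>\<^bsub>?T\<^esub> (x, 0)"
      using g xT by (simp only: T.m_assoc T.m_closed T.inv_closed T.l_inv T.r_one)
    then have eq: "(w, 0) \<otimes>\<^bsub>?T\<^esub> (0, 1) = (0, 1) \<otimes>\<^bsub>?T\<^esub> (x, 0)" unfolding w .
    have f0: "f (0, 1) = 0" by (simp add: f_def)
    have pw0: "fst (twist_power s t (0, k)) = 0" for t k
      by (induct t rule: F3_induct) (simp_all only: twist_power_simps s_def map_prod_simp fst_conv rot_simps)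
    have "w = x"
      using arg_cong[OF eq, of fst] by (simp add: f0 twist_power_simps G_def mult_DirProd' pw0)
    then have "mult_pow3 d 1 mod int ?r = 1 mod int ?r"
      using arg_cong[OF eq, of snd]
      by (simp add: f0 fx twist_power_simps G_def mult_DirProd' s_def multK)
    moreover have "mult_pow3 d 1 = 3 ^ d mod int ?r" by (simp add: mult_pow3_def)
    moreover have "(3 ^ d) mod int ?r = 3 ^ d"
      using r(1) by (intro mod_pos_pos_trivial) (simp_all flip: of_nat_power)
    ultimately show False using r m by simp
  qed
  show ?thesis
    by (rule transport_to_nat[OF group_twist fin sylow D _ _ nonabelian g _ nonnormal]) (use xy in auto)
qed

end
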